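(* Let $k\ge1$ and $t\ge0$ be integers and $0<\theta\le1$. Then, with the limit taken over integers $m\ge k$, $$\lim_{m\to\infty}\operatorname{NegOcc}(t\mid m,k,\theta)=\operatorname{NegBin}(t\mid k,1-\theta).$$
   Context: Noncentral Stirling numbers of the second kind: for an integer $n\ge0$ and real $\phi$, the numbers $S(n,k,\phi)$, $0\le k\le n$, are defined by the polynomial identity $(x+\phi)^n=\sum_{k=0}^n S(n,k,\phi)(x)_k$, where $(x)_k=\prod_{i=0}^{k-1}(x-i)$; $S(n,k,\phi)=0$ for $k>n$. Convention $0^0=1$. Negative occupancy distribution: for integers $1\le k\le m<\infty$, $t\ge0$, and $0<\theta\le1$, $\operatorname{NegOcc}(t\mid m,k,\theta)=\frac{\theta^{k+t}}{m^{k+t}}(m)_k\,S\big(k+t-1,k-1,m\tfrac{1-\theta}{\theta}\big)$. Negative binomial: $\operatorname{NegBin}(t\mid k,p)=\binom{k+t-1}{t}p^t(1-p)^k$ for $t=0,1,2,\dots$. *)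

theory Defs
  imports "HOL-Probability.Probability_Mass_Function"
begin

definition falling_fact :: "real \<Rightarrow> nat \<Rightarrow> real" where
  "falling_fact x k = (\<Prod>i<k. x - real i)"

text \<open>
  The noncentral Stirling numbers of the second kind are the coefficients of the polynomial
  \<open>(x + \<phi>)^n\<close> in the basis of falling factorials. A polynomial identity over the reals is
  rendered as equality at every real point. The description is shown to be
  well-defined in \<open>ex1_nc_stirling2_coeffs\<close>.
\<close>

definition nc_stirling2_coeffs :: "nat \<Rightarrow> real \<Rightarrow> (nat \<Rightarrow> real) \<Rightarrow> bool" where
  "nc_stirling2_coeffs n \<phi> c \<longleftrightarrow>
     (\<forall>x::real. (x + \<phi>) ^ n = (\<Sum>k\<le>n. c k * falling_fact x k)) \<and> (\<forall>k>n. c k = 0)"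

definition nc_stirling2 :: "nat \<Rightarrow> nat \<Rightarrow> real \<Rightarrow> real" where
  "nc_stirling2 n k \<phi> = (THE c. nc_stirling2_coeffs n \<phi> c) k"

text \<open>Only meaningful for \<open>1 \<le> k \<le> m\<close> and \<open>0 < \<theta> \<le> 1\<close>.\<close>

definition neg_occ :: "nat \<Rightarrow> nat \<Rightarrow> nat \<Rightarrow> real \<Rightarrow> real" where
  "neg_occ t m k \<theta> =
     \<theta> ^ (k + t) / real m ^ (k + t) * falling_fact (real m) k
       * nc_stirling2 (k + t - 1) (k - 1) (real m * ((1 - \<theta>) / \<theta>))"

text \<open>
  The parameter \<open>p\<close> is the weight of the events being counted, so it is complementary to the
  parameter of \<open>neg_binomial_pmf\<close>; see \<open>neg_bin_eq_pmf\<close>.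
\<close>

definition neg_bin :: "nat \<Rightarrow> nat \<Rightarrow> real \<Rightarrow> real" where
  "neg_bin t k p = real ((k + t - 1) choose t) * p ^ t * (1 - p) ^ k"

lemma neg_bin_eq_pmf:
  assumes "0 \<le> p" "p < 1"
  shows "neg_bin t k p = pmf (neg_binomial_pmf k (1 - p)) t"
  using assms by (simp add: neg_bin_def pmf_neg_binomial add.commute mult_ac)

lemma falling_fact_of_nat_eq_0: "j < k \<Longrightarrow> falling_fact (real j) k = 0"
  by (auto simp: falling_fact_def)

lemma falling_fact_of_nat_self: "falling_fact (real k) k \<noteq> 0"
  by (auto simp: falling_fact_def)

lemma falling_fact_Suc: "falling_fact x (Suc k) = falling_fact x k * (x - real k)"
  by (simp add: falling_fact_def)

lemma nc_stirling2_coeffs_exist: "\<exists>c. nc_stirling2_coeffs n \<phi> c"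
proof (induction n)
  case 0
  show ?case
    by (rule exI[of _ "\<lambda>k. if k = 0 then 1 else 0"])
       (simp add: nc_stirling2_coeffs_def falling_fact_def)
next
  case (Suc n)
  then obtain c where c: "\<And>x. (x + \<phi>) ^ n = (\<Sum>k\<le>n. c k * falling_fact x k)"
    and c0: "\<And>k. k > n \<Longrightarrow> c k = 0"
    unfolding nc_stirling2_coeffs_def by blast
  define d where "d = (\<lambda>k. (if k = 0 then 0 else c (k - 1)) + (real k + \<phi>) * c k)"
  have "(x + \<phi>) ^ Suc n = (\<Sum>k\<le>Suc n. d k * falling_fact x k)" for x
  proof -
    have "(x + \<phi>) ^ Suc n = (\<Sum>k\<le>n. c k * falling_fact x k) * (x + \<phi>)"
      using c by simp
    also have "\<dots> = (\<Sum>k\<le>n. c k * falling_fact x (Suc k) + (real k + \<phi>) * c k * falling_fact x k)"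
      unfolding sum_distrib_right
      by (rule sum.cong) (simp_all add: falling_fact_Suc algebra_simps)
    also have "\<dots> = (\<Sum>k\<le>n. c k * falling_fact x (Suc k))
        + (\<Sum>k\<le>Suc n. (real k + \<phi>) * c k * falling_fact x k)"
      using c0[of "Suc n"] by (simp add: sum.distrib)
    also have "(\<Sum>k\<le>n. c k * falling_fact x (Suc k))
        = (\<Sum>k\<le>Suc n. (if k = 0 then 0 else c (k - 1)) * falling_fact x k)"
      by (subst sum.atMost_Suc_shift) simp
    finally show ?thesis
      by (simp only: d_def distrib_right sum.distrib)
  qed
  moreover have "d k = 0" if "k > Suc n" for k
    using that c0 by (simp add: d_def)
  ultimately show ?case
    unfolding nc_stirling2_coeffs_def by blast
qed

lemma nc_stirling2_coeffs_unique:
  assumes "nc_stirling2_coeffs n \<phi> c" "nc_stirling2_coeffs n \<phi> d"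
  shows "c = d"
proof
  have eq: "(\<Sum>k\<le>n. c k * falling_fact x k) = (\<Sum>k\<le>n. d k * falling_fact x k)" for x
    using assms by (metis nc_stirling2_coeffs_def)
  fix j
  show "c j = d j"
  proof (induction j rule: less_induct)
    case (less j)
    show ?case
    proof (cases "j \<le> n")
      case True
      have split: "(\<Sum>k\<le>n. e k * falling_fact (real j) k)
          = (\<Sum>k<j. e k * falling_fact (real j) k) + e j * falling_fact (real j) j" for e
      proof -
        have "(\<Sum>k\<le>n. e k * falling_fact (real j) k) = (\<Sum>k\<le>j. e k * falling_fact (real j) k)"
          using True by (intro sum.mono_neutral_right) (auto simp: falling_fact_of_nat_eq_0)
        then show ?thesis
          by (simp add: lessThan_Suc_atMost[symmetric])
      qed
      have "(\<Sum>k<j. c k * falling_fact (real j) k) = (\<Sum>k<j. d k * falling_fact (real j) k)"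
        using less by simp
      with eq[of "real j"] show ?thesis
        by (simp add: split falling_fact_of_nat_self)
    next
      case False
      then show ?thesis
        using assms by (simp add: nc_stirling2_coeffs_def)
    qed
  qed
qed

lemma ex1_nc_stirling2_coeffs: "\<exists>!c. nc_stirling2_coeffs n \<phi> c"
  using nc_stirling2_coeffs_exist nc_stirling2_coeffs_unique by blast

lemma nc_stirling2_coeffs_nc_stirling2:
  "nc_stirling2_coeffs n \<phi> (\<lambda>k. nc_stirling2 n k \<phi>)"
  unfolding nc_stirling2_def using theI'[OF ex1_nc_stirling2_coeffs] by simp

end

theory Submission
  imports Defs
begin

text \<open>
  By the triangular recurrence \<open>S(n+1,k,\<phi>) = S(n,k-1,\<phi>) + (k+\<phi>) S(n,k,\<phi>)\<close>, the numbers
  \<open>m\<^sup>-\<^sup>t S(j+t,j,ma)\<close> satisfy a recurrence which in the limit \<open>m \<rightarrow> \<infinity>\<close> becomes Pascal's rule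
  multiplied by \<open>a\<^sup>t\<close>. Hence they tend to \<open>a\<^sup>t\<close> times the binomial coefficient of \<open>j+t\<close> over \<open>t\<close>,
  and since the falling factorial of \<open>m\<close> is asymptotic to \<open>m\<^sup>k\<close>, the theorem is the case
  \<open>j = k-1\<close>, \<open>a = (1-\<theta>)/\<theta>\<close>.
\<close>

lemma nc_stirling2_eqI: "nc_stirling2_coeffs n \<phi> c \<Longrightarrow> nc_stirling2 n k \<phi> = c k"
  using nc_stirling2_coeffs_unique nc_stirling2_coeffs_nc_stirling2 by metis

lemma nc_stirling2_eq_0: "n < k \<Longrightarrow> nc_stirling2 n k \<phi> = 0"
  using nc_stirling2_coeffs_nc_stirling2 by (simp add: nc_stirling2_coeffs_def)

lemma nc_stirling2_0_0: "nc_stirling2 0 0 \<phi> = 1"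
  using nc_stirling2_coeffs_nc_stirling2[of 0 \<phi>]
  by (simp add: nc_stirling2_coeffs_def falling_fact_def)

text \<open>Multiplying the defining identity by \<open>x + \<phi>\<close> and writing this factor
  as \<open>(x - k) + (k + \<phi>)\<close> in the k-th term raises or keeps the index of the falling
  factorial; uniqueness of coefficients then identifies \<open>d\<close>.\<close>

lemma nc_stirling2_rec:
  "nc_stirling2 (Suc n) k \<phi> =
    (if k = 0 then 0 else nc_stirling2 n (k - 1) \<phi>) + (real k + \<phi>) * nc_stirling2 n k \<phi>"
proof -
  define c where "c = (\<lambda>k. nc_stirling2 n k \<phi>)"
  have c: "(x + \<phi>) ^ n = (\<Sum>k\<le>n. c k * falling_fact x k)" and c0: "k > n \<Longrightarrow> c k = 0" for x k
    using nc_stirling2_coeffs_nc_stirling2[of n \<phi>] by (auto simp: nc_stirling2_coeffs_def c_def)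
  define d where "d = (\<lambda>k. (if k = 0 then 0 else c (k - 1)) + (real k + \<phi>) * c k)"
  have "(x + \<phi>) ^ Suc n = (\<Sum>k\<le>Suc n. d k * falling_fact x k)" for x
  proof -
    have "(\<Sum>k\<le>Suc n. d k * falling_fact x k)
        = (\<Sum>k\<le>Suc n. (if k = 0 then 0 else c (k - 1)) * falling_fact x k)
          + (\<Sum>k\<le>Suc n. (real k + \<phi>) * c k * falling_fact x k)"
      by (simp only: d_def distrib_right sum.distrib)
    also have "\<dots> = (\<Sum>k\<le>n. c k * falling_fact x (Suc k))
          + (\<Sum>k\<le>n. (real k + \<phi>) * c k * falling_fact x k)"
      \<comment> \<open>The top term of the second sum vanishes since
        \<open>c (Suc n) = 0\<close>.\<close>
      using c0[of "Suc n"] by (subst sum.atMost_Suc_shift) simp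
    also have "\<dots> = (\<Sum>k\<le>n. c k * falling_fact x k * (x + \<phi>))"
      unfolding sum.distrib[symmetric]
      by (rule sum.cong) (simp_all add: falling_fact_Suc algebra_simps)
    also have "\<dots> = (x + \<phi>) ^ Suc n"
      by (simp only: c power_Suc2 sum_distrib_right)
    finally show ?thesis ..
  qed
  then have "nc_stirling2_coeffs (Suc n) \<phi> d"
    by (simp add: nc_stirling2_coeffs_def d_def c0)
  then show ?thesis
    by (simp add: nc_stirling2_eqI d_def c_def)
qed

lemma nc_stirling2_self: "nc_stirling2 n n \<phi> = 1"
  by (induction n) (simp_all add: nc_stirling2_0_0 nc_stirling2_rec nc_stirling2_eq_0)

text \<open>The recurrence leads from \<open>(Suc j, Suc t)\<close> to \<open>(j, Suc t)\<close> and
  \<open>(Suc j, t)\<close>, hence an induction on \<open>j\<close> inside one on \<open>t\<close>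
  with \<open>j\<close> arbitrary.\<close>

lemma tendsto_nc_stirling2_scaled:
  fixes a :: real
  shows "(\<lambda>m. nc_stirling2 (j + t) j (real m * a) / real m ^ t)
           \<longlonglongrightarrow> real ((j + t) choose t) * a ^ t"
proof (induction t arbitrary: j)
  case 0
  show ?case by (simp add: nc_stirling2_self)
next
  case (Suc t)
  \<comment> \<open>This is the second summand of the recurrence: the extra power of
    \<open>m\<close> turns the factor \<open>j + m * a\<close> into \<open>j / m + a\<close>, which
    tends to \<open>a\<close>.\<close>
  have step: "(\<lambda>m. (real j + real m * a) * nc_stirling2 (j + t) j (real m * a) / real m ^ Suc t)
      \<longlonglongrightarrow> a * (real ((j + t) choose t) * a ^ t)" for j
  proof -
    have "(\<lambda>m. (real j / real m + a) * (nc_stirling2 (j + t) j (real m * a) / real m ^ t))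
        \<longlonglongrightarrow> (0 + a) * (real ((j + t) choose t) * a ^ t)"
      by (intro tendsto_intros Suc lim_const_over_n)
    moreover have "\<forall>\<^sub>F m in sequentially.
        (real j / real m + a) * (nc_stirling2 (j + t) j (real m * a) / real m ^ t) =
        (real j + real m * a) * nc_stirling2 (j + t) j (real m * a) / real m ^ Suc t"
      using eventually_gt_at_top[of 0] by eventually_elim (simp add: field_simps)
    ultimately show ?thesis
      by (simp add: tendsto_cong)
  qed
  show ?case
  proof (induction j)
    case 0
    show ?case using step[of 0] by (simp add: nc_stirling2_rec)
  next
    case (Suc j)
    from tendsto_add[OF Suc.IH step[of "Suc j"]] show ?case
      by (simp add: nc_stirling2_rec[of "Suc (j + t)" "Suc j"] add_divide_distrib algebra_simps)
  qed
qed

text \<open>For fixed \<open>k\<close> this is a product of \<open>k\<close> factors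
  \<open>1 - i / m\<close>, each tending to 1.\<close>

lemma tendsto_falling_fact_scaled: "(\<lambda>m. falling_fact (real m) k / real m ^ k) \<longlonglongrightarrow> 1"
proof -
  have "(\<lambda>m. \<Prod>i<k. (1 - real i / real m)) \<longlonglongrightarrow> (\<Prod>i<k. (1 - 0))"
    by (intro tendsto_intros lim_const_over_n)
  moreover have "\<forall>\<^sub>F m in sequentially.
      (\<Prod>i<k. (1 - real i / real m)) = falling_fact (real m) k / real m ^ k"
    using eventually_gt_at_top[of 0]
  proof eventually_elim
    case (elim m)
    then have "(\<Prod>i<k. (1 - real i / real m)) = (\<Prod>i<k. (real m - real i) / real m)"
      by (intro prod.cong) (auto simp: field_simps)
    then show ?case
      by (simp add: falling_fact_def prod_dividef)
  qed
  ultimately show ?thesis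
    by (simp add: tendsto_cong)
qed

theorem theorem7:
  fixes k t :: nat and \<theta> :: real
  assumes "k \<ge> 1" and "0 < \<theta>" and "\<theta> \<le> 1"
  shows "(\<lambda>m::nat. neg_occ t m k \<theta>) \<longlonglongrightarrow> neg_bin t k (1 - \<theta>)"
proof -
  define a where "a = (1 - \<theta>) / \<theta>"
  obtain j where k: "k = Suc j"
    using assms by (cases k) auto
  have "(\<lambda>m. \<theta> ^ (k + t) * (falling_fact (real m) k / real m ^ k)
          * (nc_stirling2 (j + t) j (real m * a) / real m ^ t))
      \<longlonglongrightarrow> \<theta> ^ (k + t) * 1 * (real ((j + t) choose t) * a ^ t)"
    by (intro tendsto_intros tendsto_falling_fact_scaled tendsto_nc_stirling2_scaled)
  \<comment> \<open>Here \<open>\<theta> ^ t\<close> cancels the denominator of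
    \<open>a ^ t\<close>, and \<open>j + t\<close> is \<open>k + t - 1\<close>.\<close>
  moreover have "\<theta> ^ (k + t) * 1 * (real ((j + t) choose t) * a ^ t) = neg_bin t k (1 - \<theta>)"
    using assms by (simp add: neg_bin_def a_def k power_add power_divide)
  moreover have "\<theta> ^ (k + t) * (falling_fact (real m) k / real m ^ k)
          * (nc_stirling2 (j + t) j (real m * a) / real m ^ t) = neg_occ t m k \<theta>" for m
    by (simp add: neg_occ_def a_def k power_add)
  ultimately show ?thesis
    by simp
qed

end
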